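(* Let $(X,\pi;M_X,I_X)$ and $(Y,\sigma;M_Y,I_Y)$ be impulsive semidynamical systems satisfying the standing assumptions. Let $x\in X$, $y\in Y$, and let $A\subset X$ be such that $A\setminus M_X$ is positively $\tilde\pi$-invariant, and assume that $\tilde L_X^+(x)\cap A\neq\emptyset$. If $y$ is comparable with $x$ with respect to the set $\tilde L_X^+(x)\cap A$, then there is a continuous mapping $h:\tilde L_X^+(x)\cap A\to\tilde L_Y^+(y)$ such that $\mathcal L_{x,q}^{+\infty}\subset\mathcal L_{y,h(q)}^{+\infty}$ for all $q\in\tilde L_X^+(x)\cap A$ and $$h(\tilde\pi(q,t))=\tilde\sigma(h(q),t)\quad\text{for all } q\in(\tilde L_X^+(x)\cap A)\setminus M_X \text{ and } t\in\mathbb R_+.$$ Moreover, if $\tilde L_X^+(x)\cap A$ is $I_X$-invariant, then this $h$ also satisfies $$h(\tilde\pi(I_X(q),t))=\tilde\sigma(h(I_X(q)),t)\quad\text{for all } q\in\tilde L_X^+(x)\cap A\cap M_X \text{ and } t\in\mathbb R_+.$$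
   Context: Let $\mathbb R_+=[0,+\infty)$. A semidynamical system $(Z,\varrho)$ on a metric space $Z$ is a continuous map $\varrho:Z\times\mathbb R_+\to Z$ with $\varrho(z,0)=z$ and $\varrho(\varrho(z,t),s)=\varrho(z,t+s)$ for all $z\in Z$, $t,s\in\mathbb R_+$. For $z\in Z$, $t\ge 0$ put $F(z,t)=\{w\in Z:\varrho(w,t)=z\}$; for $D\subset Z$, $\Delta\subset[0,+\infty)$ put $F(D,\Delta)=\bigcup_{z\in D,\,t\in\Delta}F(z,t)$ (singletons are written without braces). A point $z$ is an initial point if $F(z,t)=\emptyset$ for all $t>0$. An impulsive semidynamical system (ISS) $(Z,\varrho;M,I)$ consists of a semidynamical system $(Z,\varrho)$, a nonempty closed set $M\subset Z$ such that for every $z\in M$ there is $\epsilon_z>0$ with $F(z,(0,\epsilon_z))\cap M=\emptyset$ and $\varrho(z,(0,\epsilon_z))\cap M=\emptyset$, and a continuous function $I:M\to Z$. Let $\phi(z)\in(0,+\infty]$ be the least $s>0$ with $\varrho(z,s)\in M$, and $\phi(z)=+\infty$ if no such $s$ exists. The impulsive trajectory $\tilde\varrho(z,\cdot)$ of $z$ is defined inductively: $z_0^+=z$, $t_0=0$; given $z_n^+$ and $t_n$, if $\phi(z_n^+)=+\infty$ then $\tilde\varrho(z,t)=\varrho(z_n^+,t-t_n)$ for all $t\ge t_n$; otherwise let $s_n=\phi(z_n^+)$, $t_{n+1}=t_n+s_n$, $\tilde\varrho(z,t)=\varrho(z_n^+,t-t_n)$ for $t_n\le t<t_{n+1}$,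 $z_{n+1}=\varrho(z_n^+,s_n)\in M$, $z_{n+1}^+=I(z_{n+1})$, and $\tilde\varrho(z,t_{n+1})=z_{n+1}^+$. Strong Tube Condition (STC): a point $z\in M$ satisfies STC if there are $\lambda>0$ and closed sets $S,L\subset Z$ with $z\in S$ such that $F(L,\lambda)=S$; $F(L,[0,2\lambda])$ is a neighborhood of $z$; $F(L,\mu)\cap F(L,\nu)=\emptyset$ for $0\le\mu<\nu\le 2\lambda$; and $S=M\cap F(L,[0,2\lambda])$. Standing assumptions on every ISS: no initial point of $(Z,\varrho)$ belongs to $M$ and every element of $M$ satisfies STC (consequently $\phi$ is continuous on $Z\setminus M$); $M\cap I(M)=\emptyset$; and $\tilde\varrho(z,t)$ is defined for all $t\ge 0$ and all $z\in Z$. Here $(X,\rho_X)$ and $(Y,\rho_Y)$ are metric spaces, and $\tilde\pi,\tilde\sigma$ denote the impulsive trajectories in $(X,\pi;M_X,I_X)$ and $(Y,\sigma;M_Y,I_Y)$. A set $A\subset X$ is positively $\tilde\pi$-invariant if $\tilde\pi(a,t)\in A$ for all $a\in A$, $t\ge0$; it is $I_X$-invariant if $I_X(A\cap M_X)\subset A$. The positive limit set $\tilde L_X^+(x)$ is the set of all $q\in X$ for which there is a sequence $\lambda_n\to+\infty$ in $\mathbb R_+$ with $\tilde\pi(x,\lambda_n)\to q$; $\tilde L_Y^+(y)$ is defined analogously with $\tilde\sigma$. For a system $(Z,\varrho;M,I)$, $z,p\in Z$ and $A\subset Z$: $\mathcal L_{z,p}^{+\infty}$ is the set of sequences $\{t_n\}_{n\in\mathbb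 N}\subset\mathbb R_+$ with $t_n\to+\infty$ and $\tilde\varrho(z,t_n)\to p$; $\mathcal L_z^{+\infty}(A)=\bigcup_{p\in A}\mathcal L_{z,p}^{+\infty}$; $\mathcal L_z^{+\infty}=\mathcal L_z^{+\infty}(Z)$. A point $y\in Y$ is comparable with $x\in X$ with respect to a set $A\subset X$ if $\mathcal L_x^{+\infty}(A)\subset\mathcal L_y^{+\infty}$. *)

theory Defs
  imports "HOL-Analysis.Analysis"
begin

text \<open>
  A metric space is a type of class \<^class>\<open>metric_space\<close>. Times are reals, and only values
  at times \<open>t \<ge> 0\<close> matter; likewise an impulse function is a total function
  of which only the values on the impulsive set \<open>M\<close> are used.
\<close>

locale semidynamical_system =
  fixes \<rho> :: "'z::metric_space \<Rightarrow> real \<Rightarrow> 'z"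
  assumes continuous_flow: "continuous_on (UNIV \<times> {0..}) (\<lambda>(z, t). \<rho> z t)"
    and flow_zero: "\<rho> z 0 = z"
    and flow_add: "0 \<le> t \<Longrightarrow> 0 \<le> s \<Longrightarrow> \<rho> (\<rho> z t) s = \<rho> z (t + s)"

definition past :: "('z \<Rightarrow> real \<Rightarrow> 'z) \<Rightarrow> 'z set \<Rightarrow> real set \<Rightarrow> 'z set" where
  "past \<rho> D \<Delta> = (\<Union>z\<in>D. \<Union>t\<in>\<Delta>. {w. \<rho> w t = z})"

definition initial_point :: "('z \<Rightarrow> real \<Rightarrow> 'z) \<Rightarrow> 'z \<Rightarrow> bool" where
  "initial_point \<rho> z \<longleftrightarrow> (\<forall>t>0. past \<rho> {z} {t} = {})"

locale impulsive_semidynamical_system = semidynamical_system \<rho>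
  for \<rho> :: "'z::metric_space \<Rightarrow> real \<Rightarrow> 'z" +
  fixes M :: "'z set" and I :: "'z \<Rightarrow> 'z"
  assumes impulsive_set_nonempty: "M \<noteq> {}"
    and closed_impulsive_set: "closed M"
    and impulsive_set_isolated: "z \<in> M \<Longrightarrow>
      \<exists>\<epsilon>>0. past \<rho> {z} {0<..<\<epsilon>} \<inter> M = {} \<and> \<rho> z ` {0<..<\<epsilon>} \<inter> M = {}"
    and continuous_impulse: "continuous_on M I"

definition hit_time :: "('z \<Rightarrow> real \<Rightarrow> 'z) \<Rightarrow> 'z set \<Rightarrow> 'z \<Rightarrow> ereal" where
  "hit_time \<rho> M z =
    (if \<exists>s>0. \<rho> z s \<in> M then ereal (LEAST s. 0 < s \<and> \<rho> z s \<in> M) else \<infinity>)"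

text \<open>
  \<open>impulse_stage \<rho> M I z n p t\<close> states that the \<open>n\<close>-th impulse from \<open>z\<close> exists, that
  \<open>t\<close> is its time, and that \<open>p\<close> is the point right after it (\<open>p = z\<close> and
  \<open>t = 0\<close> if \<open>n = 0\<close>).
\<close>

inductive impulse_stage ::
  "('z \<Rightarrow> real \<Rightarrow> 'z) \<Rightarrow> 'z set \<Rightarrow> ('z \<Rightarrow> 'z) \<Rightarrow> 'z \<Rightarrow> nat \<Rightarrow> 'z \<Rightarrow> real \<Rightarrow> bool"
  for \<rho> M I z where
  zero: "impulse_stage \<rho> M I z 0 z 0"
| Suc: "impulse_stage \<rho> M I z n p t \<Longrightarrow> hit_time \<rho> M p = ereal s \<Longrightarrow>
    impulse_stage \<rho> M I z (Suc n) (I (\<rho> p s)) (t + s)"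

text \<open>
  The impulsive trajectory is a priori only partially defined (impulse times may accumulate), so it
  is introduced through its graph.
\<close>

definition impulsive_graph ::
  "('z \<Rightarrow> real \<Rightarrow> 'z) \<Rightarrow> 'z set \<Rightarrow> ('z \<Rightarrow> 'z) \<Rightarrow> 'z \<Rightarrow> real \<Rightarrow> 'z \<Rightarrow> bool" where
  "impulsive_graph \<rho> M I z t w \<longleftrightarrow>
    (\<exists>n p s. impulse_stage \<rho> M I z n p s \<and> s \<le> t \<and> ereal t < ereal s + hit_time \<rho> M p
      \<and> w = \<rho> p (t - s))"

definition impulsive_trajectory ::
  "('z \<Rightarrow> real \<Rightarrow> 'z) \<Rightarrow> 'z set \<Rightarrow> ('z \<Rightarrow> 'z) \<Rightarrow> 'z \<Rightarrow> real \<Rightarrow> 'z" where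
  "impulsive_trajectory \<rho> M I z t = (THE w. impulsive_graph \<rho> M I z t w)"

definition strong_tube_condition ::
  "('z::metric_space \<Rightarrow> real \<Rightarrow> 'z) \<Rightarrow> 'z set \<Rightarrow> 'z \<Rightarrow> bool" where
  "strong_tube_condition \<rho> M z \<longleftrightarrow>
    (\<exists>\<kappa>>0. \<exists>S L. closed S \<and> closed L \<and> z \<in> S
      \<and> past \<rho> L {\<kappa>} = S
      \<and> z \<in> interior (past \<rho> L {0..2 * \<kappa>})
      \<and> (\<forall>\<mu> \<nu>. 0 \<le> \<mu> \<and> \<mu> < \<nu> \<and> \<nu> \<le> 2 * \<kappa> \<longrightarrow> past \<rho> L {\<mu>} \<inter> past \<rho> L {\<nu>} = {})
      \<and> S = M \<inter> past \<rho> L {0..2 * \<kappa>})"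

locale standing_impulsive_system = impulsive_semidynamical_system +
  assumes no_initial_point: "z \<in> M \<Longrightarrow> \<not> initial_point \<rho> z"
    and strong_tube: "z \<in> M \<Longrightarrow> strong_tube_condition \<rho> M z"
    and impulse_leaves: "M \<inter> I ` M = {}"
    and trajectory_defined: "0 \<le> t \<Longrightarrow> \<exists>w. impulsive_graph \<rho> M I z t w"

definition positively_invariant ::
  "('z \<Rightarrow> real \<Rightarrow> 'z) \<Rightarrow> 'z set \<Rightarrow> ('z \<Rightarrow> 'z) \<Rightarrow> 'z set \<Rightarrow> bool" where
  "positively_invariant \<rho> M I A \<longleftrightarrow> (\<forall>a\<in>A. \<forall>t\<ge>0. impulsive_trajectory \<rho> M I a t \<in> A)"

definition impulse_invariant :: "'z set \<Rightarrow> ('z \<Rightarrow> 'z) \<Rightarrow> 'z set \<Rightarrow> bool" where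
  "impulse_invariant M I A \<longleftrightarrow> I ` (A \<inter> M) \<subseteq> A"

definition limit_times ::
  "('z::metric_space \<Rightarrow> real \<Rightarrow> 'z) \<Rightarrow> 'z set \<Rightarrow> ('z \<Rightarrow> 'z) \<Rightarrow> 'z \<Rightarrow> 'z \<Rightarrow> (nat \<Rightarrow> real) set" where
  "limit_times \<rho> M I z p =
    {t. (\<forall>n. 0 \<le> t n) \<and> filterlim t at_top sequentially
      \<and> (\<lambda>n. impulsive_trajectory \<rho> M I z (t n)) \<longlonglongrightarrow> p}"

definition limit_times_in ::
  "('z::metric_space \<Rightarrow> real \<Rightarrow> 'z) \<Rightarrow> 'z set \<Rightarrow> ('z \<Rightarrow> 'z) \<Rightarrow> 'z \<Rightarrow> 'z set \<Rightarrow> (nat \<Rightarrow> real) set" where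
  "limit_times_in \<rho> M I z A = (\<Union>p\<in>A. limit_times \<rho> M I z p)"

definition positive_limit_set ::
  "('z::metric_space \<Rightarrow> real \<Rightarrow> 'z) \<Rightarrow> 'z set \<Rightarrow> ('z \<Rightarrow> 'z) \<Rightarrow> 'z \<Rightarrow> 'z set" where
  "positive_limit_set \<rho> M I z =
    {q. \<exists>t. (\<forall>n. 0 \<le> t n) \<and> filterlim t at_top sequentially
      \<and> (\<lambda>n. impulsive_trajectory \<rho> M I z (t n)) \<longlonglongrightarrow> q}"

definition comparable ::
  "('y::metric_space \<Rightarrow> real \<Rightarrow> 'y) \<Rightarrow> 'y set \<Rightarrow> ('y \<Rightarrow> 'y) \<Rightarrow> 'y \<Rightarrow>
   ('x::metric_space \<Rightarrow> real \<Rightarrow> 'x) \<Rightarrow> 'x set \<Rightarrow> ('x \<Rightarrow> 'x) \<Rightarrow> 'x \<Rightarrow> 'x set \<Rightarrow> bool" where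
  "comparable \<sigma> MY IY y \<pi> MX IX x A \<longleftrightarrow>
    limit_times_in \<pi> MX IX x A \<subseteq> limit_times_in \<sigma> MY IY y UNIV"

text \<open>
  The following facts justify the use of \<open>LEAST\<close> and \<open>THE\<close> above: in an impulsive
  system the least hitting time exists whenever it is finite, and the graph is single-valued.
\<close>

context impulsive_semidynamical_system
begin

lemma continuous_on_orbit: "continuous_on {0..} (\<rho> z)"
proof -
  have "continuous_on {0..} (\<lambda>t. (\<lambda>(z, t). \<rho> z t) (z, t))"
    by (rule continuous_on_compose2[OF continuous_flow]) (auto intro!: continuous_intros)
  then show ?thesis by simp
qed

lemma eventually_off_impulsive_set:
  "\<exists>\<delta>>0. \<forall>s. 0 < s \<and> s < \<delta> \<longrightarrow> \<rho> z s \<notin> M"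
proof (cases "z \<in> M")
  case True
  from impulsive_set_isolated[OF this] obtain \<epsilon>
    where "\<epsilon> > 0" "\<rho> z ` {0<..<\<epsilon>} \<inter> M = {}" by blast
  then show ?thesis by (intro exI[of _ \<epsilon>]) (auto simp: disjoint_iff)
next
  case False
  then obtain e where e: "e > 0" "\<And>w. dist w z < e \<Longrightarrow> w \<notin> M"
    using closed_impulsive_set unfolding closed_def open_dist by auto
  obtain d where d: "d > 0" "\<And>s. s \<in> {0..} \<Longrightarrow> dist s 0 < d \<Longrightarrow> dist (\<rho> z s) (\<rho> z 0) < e"
    using continuous_on_orbit[of z, unfolded continuous_on_iff] e(1)
    by (metis atLeast_iff order_refl)
  show ?thesis
    using d e(2) flow_zero by (intro exI[of _ d]) (auto simp: dist_real_def)
qed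

lemma hit_time_eq_ereal_iff:
  "hit_time \<rho> M z = ereal s \<longleftrightarrow>
    0 < s \<and> \<rho> z s \<in> M \<and> (\<forall>r. 0 < r \<and> r < s \<longrightarrow> \<rho> z r \<notin> M)"
proof -
  define P where "P = (\<lambda>s. 0 < s \<and> \<rho> z s \<in> M)"
  have ex: "\<exists>m. P m \<and> (\<forall>r. P r \<longrightarrow> m \<le> r)" if "\<exists>s. P s"
  proof -
    obtain d where d: "d > 0" "\<And>s. 0 < s \<Longrightarrow> s < d \<Longrightarrow> \<rho> z s \<notin> M"
      using eventually_off_impulsive_set[of z] by auto
    have "closed ({d..} \<inter> \<rho> z -` M)"
      using continuous_on_subset[OF continuous_on_orbit[of z], of "{d..}"] d(1) closed_impulsive_set
      by (intro continuous_closed_preimage) auto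
    moreover have eq: "{d..} \<inter> \<rho> z -` M = Collect P"
      using d unfolding P_def by force
    ultimately have "closed (Collect P)" by simp
    moreover have bd: "bdd_below (Collect P)"
      by (rule bdd_belowI[of _ 0]) (auto simp: P_def)
    ultimately have "Inf (Collect P) \<in> Collect P"
      using that by (intro closed_contains_Inf) auto
    then show ?thesis using bd by (intro exI[of _ "Inf (Collect P)"]) (auto intro: cInf_lower)
  qed
  have *: "hit_time \<rho> M z = (if \<exists>s. P s then ereal (LEAST s. P s) else \<infinity>)"
    unfolding hit_time_def P_def by simp
  show ?thesis
  proof (cases "\<exists>s. P s")
    case True
    from ex[OF this] obtain m where m: "P m" "\<And>r. P r \<Longrightarrow> m \<le> r" by blast
    then have "(LEAST s. P s) = m" by (intro Least_equality) auto
    then have "hit_time \<rho> M z = ereal s \<longleftrightarrow> m = s" using * True by simp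
    also have "\<dots> \<longleftrightarrow> P s \<and> (\<forall>r. 0 < r \<and> r < s \<longrightarrow> \<rho> z r \<notin> M)"
      using m unfolding P_def by (metis leD linorder_neqE_linordered_idom)
    finally show ?thesis unfolding P_def by blast
  next
    case False
    then show ?thesis using * unfolding P_def by auto
  qed
qed

lemma impulse_stage_unique:
  assumes "impulse_stage \<rho> M I z n p t" "impulse_stage \<rho> M I z n p' t'"
  shows "p = p' \<and> t = t'"
  using assms
proof (induction arbitrary: p' t')
  case zero
  then show ?case by (auto elim: impulse_stage.cases)
next
  case (Suc n p t s)
  from Suc.prems obtain p0 t0 s0
    where "impulse_stage \<rho> M I z n p0 t0" "hit_time \<rho> M p0 = ereal s0"
      "p' = I (\<rho> p0 s0)" "t' = t0 + s0"
    by (auto elim: impulse_stage.cases)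
  then show ?case using Suc.IH[of p0 t0] Suc.hyps by auto
qed

lemma impulse_stage_later:
  assumes "impulse_stage \<rho> M I z m q r" "impulse_stage \<rho> M I z n p t" "n < m"
  shows "ereal t + hit_time \<rho> M p \<le> ereal r"
  using assms
proof (induction)
  case zero
  then show ?case by simp
next
  case (Suc m q r s)
  show ?case
  proof (cases "n = m")
    case True
    with impulse_stage_unique[OF Suc.hyps(1)] Suc.prems(1) have "p = q" "t = r" by blast+
    then show ?thesis using Suc.hyps(2) by simp
  next
    case False
    then have "ereal t + hit_time \<rho> M p \<le> ereal r"
      using Suc.prems by (intro Suc.IH) auto
    also have "\<dots> \<le> ereal (r + s)" using Suc.hyps(2) by (simp add: hit_time_eq_ereal_iff)
    finally show ?thesis .
  qed
qed

lemma impulsive_graph_unique: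
  assumes "impulsive_graph \<rho> M I z t w" "impulsive_graph \<rho> M I z t w'"
  shows "w = w'"
proof -
  obtain n p s where 1: "impulse_stage \<rho> M I z n p s" "s \<le> t"
      "ereal t < ereal s + hit_time \<rho> M p" "w = \<rho> p (t - s)"
    using assms(1) unfolding impulsive_graph_def by blast
  obtain n' p' s' where 2: "impulse_stage \<rho> M I z n' p' s'" "s' \<le> t"
      "ereal t < ereal s' + hit_time \<rho> M p'" "w' = \<rho> p' (t - s')"
    using assms(2) unfolding impulsive_graph_def by blast
  have "\<not> n < n'" using impulse_stage_later[OF 2(1) 1(1)] 1(3) 2(2)
    by (meson ereal_less_eq(3) leD order_trans)
  moreover have "\<not> n' < n" using impulse_stage_later[OF 1(1) 2(1)] 2(3) 1(2)
    by (meson ereal_less_eq(3) leD order_trans)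
  ultimately have "n = n'" by simp
  then show ?thesis using impulse_stage_unique[OF 1(1)] 1(4) 2(1,4) by blast
qed

end

lemma (in standing_impulsive_system) impulsive_trajectory_eq_iff:
  "0 \<le> t \<Longrightarrow> impulsive_trajectory \<rho> M I z t = w \<longleftrightarrow> impulsive_graph \<rho> M I z t w"
  using trajectory_defined[of t z] impulsive_graph_unique[of z t]
  unfolding impulsive_trajectory_def by (metis the_equality)

end

(*
  A time sequence along which x tends to q is, by comparability, one along which y has a limit;
  interleaving shows that the limit depends on q only, and it is h(q). A diagonal argument gives
  continuity. For the conjugacy, impulsive trajectories depend continuously on the initial point
  at all times that are not impulse times, provided that the first hitting times stay away from 0:
  this is automatic at q outside M_X. At h(q), which may lie in M_Y, it holds because otherwise
  the trajectory of y would jump at once to I_Y(h(q)), while continuity of h makes the limits at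
  small times return to h(q). The countably many impulse times are handled by right continuity.
*)
theory Submission
  imports Defs
begin

section \<open>Limits along the flow and closedness of pasts\<close>

lemma mem_past_iff: "w \<in> past \<rho> D \<Delta> \<longleftrightarrow> (\<exists>t\<in>\<Delta>. \<rho> w t \<in> D)"
  unfolding past_def by auto

text \<open>The filter is arbitrary because both sequences and \<open>at_right 0\<close> occur
  below; times such as \<open>t - S n\<close> are nonnegative only eventually.\<close>

lemma (in semidynamical_system) tendsto_flow:
  assumes "(w \<longlongrightarrow> q) F" "(\<tau> \<longlongrightarrow> t) F" "0 \<le> t" "\<forall>\<^sub>F n in F. 0 \<le> \<tau> n"
  shows "((\<lambda>n. \<rho> (w n) (\<tau> n)) \<longlongrightarrow> \<rho> q t) F"
proof -
  have "((\<lambda>n. (\<lambda>(z, t). \<rho> z t) (w n, \<tau> n)) \<longlongrightarrow> (\<lambda>(z, t). \<rho> z t) (q, t)) F"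
    using assms by (intro continuous_on_tendsto_compose[OF continuous_flow] tendsto_Pair)
      (auto elim: eventually_mono)
  then show ?thesis by simp
qed

text \<open>By compactness of \<Delta>, the times at which the approximating orbits meet
  \<open>D\<close> subconverge to a time at which the limit orbit does. Conditions "no hit during
  \<Delta>" are therefore stable under small perturbations.\<close>

lemma (in semidynamical_system) closed_past:
  assumes "compact \<Delta>" "\<Delta> \<subseteq> {0..}" "closed D"
  shows "closed (past \<rho> D \<Delta>)"
  unfolding closed_sequential_limits
proof (intro allI impI, elim conjE)
  fix w l assume w: "\<forall>n. w n \<in> past \<rho> D \<Delta>" "w \<longlonglongrightarrow> l"
  then obtain \<tau> where \<tau>: "\<And>n. \<tau> n \<in> \<Delta>" "\<And>n. \<rho> (w n) (\<tau> n) \<in> D"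
    unfolding mem_past_iff by metis
  obtain t r where t: "t \<in> \<Delta>" "strict_mono r" "(\<tau> \<circ> r) \<longlonglongrightarrow> t"
    using assms(1) \<tau>(1) unfolding compact_def by blast
  have "(\<lambda>n. \<rho> ((w \<circ> r) n) ((\<tau> \<circ> r) n)) \<longlonglongrightarrow> \<rho> l t"
  proof (rule tendsto_flow)
    show "(w \<circ> r) \<longlonglongrightarrow> l" using w(2) t(2) by (rule LIMSEQ_subseq_LIMSEQ)
    show "\<forall>\<^sub>F n in sequentially. 0 \<le> (\<tau> \<circ> r) n"
      using \<tau>(1) assms(2) by (intro always_eventually) auto
  qed (use t assms(2) in \<open>auto simp del: o_apply\<close>)
  then have "\<rho> l t \<in> D"
    by (rule closed_sequentially[OF assms(3), rotated]) (simp add: \<tau>(2))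
  then show "l \<in> past \<rho> D \<Delta>" using t(1) unfolding mem_past_iff by blast
qed

lemma tendsto_eventually_notin_closed:
  assumes "(w \<longlongrightarrow> q) F" "closed C" "q \<notin> C"
  shows "\<forall>\<^sub>F n in F. w n \<notin> C"
  using topological_tendstoD[OF assms(1), of "- C"] assms(2,3) by (simp add: open_Compl)

section \<open>Hitting times, impulse stages and lower bounds near a point\<close>

context impulsive_semidynamical_system
begin

text \<open>The least hit is attained, hence \<open>T\<close> itself is included among the forbidden
  times. This turns bounds on hitting times into statements about
  \<open>past \<rho> M\<close>.\<close>

lemma less_hit_time_iff:
  assumes "0 \<le> T"
  shows "ereal T < hit_time \<rho> M z \<longleftrightarrow> (\<forall>r. 0 < r \<and> r \<le> T \<longrightarrow> \<rho> z r \<notin> M)"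
proof (cases "\<exists>s>0. \<rho> z s \<in> M")
  case True
  then obtain s where s: "hit_time \<rho> M z = ereal s" unfolding hit_time_def by auto
  show ?thesis using s[unfolded hit_time_eq_ereal_iff] unfolding s
    by (auto simp: not_less)
next
  case False
  then show ?thesis unfolding hit_time_def by auto
qed

lemma hit_time_pos: "0 < hit_time \<rho> M z"
  using less_hit_time_iff[of 0 z] by (force simp: zero_ereal_def)

lemma hit_time_flow:
  assumes "0 \<le> r" "ereal r < hit_time \<rho> M z"
  shows "ereal r + hit_time \<rho> M (\<rho> z r) = hit_time \<rho> M z"
proof (cases "hit_time \<rho> M z")
  case (real s)
  have "hit_time \<rho> M (\<rho> z r) = ereal (s - r)"
    using real[unfolded hit_time_eq_ereal_iff] assms unfolding real
    by (auto simp: hit_time_eq_ereal_iff flow_add)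
  then show ?thesis using real by simp
next
  case PInf
  then have *: "\<rho> z t \<notin> M" if "t > 0" for t
    using less_hit_time_iff[of t z] that by auto
  have "hit_time \<rho> M (\<rho> z r) = \<infinity>"
    using * assms(1) unfolding hit_time_def by (auto simp: flow_add)
  then show ?thesis using PInf by simp
qed (use hit_time_pos[of z] in auto)

lemma impulse_stage_nonneg: "impulse_stage \<rho> M I z n p t \<Longrightarrow> 0 \<le> t"
  by (induction rule: impulse_stage.induct) (auto simp: hit_time_eq_ereal_iff)

text \<open>The number of an impulse determines its time, so the times are indexed by naturals.
  Countability later permits choosing times that avoid all impulses.\<close>

lemma countable_impulse_times: "countable {t. \<exists>n p. impulse_stage \<rho> M I z n p t}"
proof -
  have "{t. \<exists>n p. impulse_stage \<rho> M I z n p t}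
      \<subseteq> range (\<lambda>n. THE t. \<exists>p. impulse_stage \<rho> M I z n p t)"
  proof clarify
    fix t n p assume "impulse_stage \<rho> M I z n p t"
    then have "(THE t. \<exists>p. impulse_stage \<rho> M I z n p t) = t"
      using impulse_stage_unique by (intro the_equality) blast+
    then show "t \<in> range (\<lambda>n. THE t. \<exists>p. impulse_stage \<rho> M I z n p t)" by blast
  qed
  then show ?thesis by (rule countable_subset) simp
qed

text \<open>The first hit after a restart at time \<open>t\<close> is the hit the original
  trajectory was heading for, so the impulse counts add. Stage 0 is exceptional: the restart point
  generally lies inside an arc and is no stage of the original.\<close>

lemma impulse_stage_shift:
  assumes "impulse_stage \<rho> M I (\<rho> p (t - s)) j p' \<tau>"
    and "impulse_stage \<rho> M I z k p s" "s \<le> t" "ereal t < ereal s + hit_time \<rho> M p"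
  shows "j = 0 \<and> p' = \<rho> p (t - s) \<and> \<tau> = 0 \<or> impulse_stage \<rho> M I z (k + j) p' (t + \<tau>)"
  using assms
proof (induction)
  case zero
  then show ?case by simp
next
  case (Suc j p' \<tau> r)
  have "impulse_stage \<rho> M I z (Suc (k + j)) (I (\<rho> p' r)) (t + \<tau> + r)"
    if "impulse_stage \<rho> M I z (k + j) p' (t + \<tau>)"
    using impulse_stage.Suc[OF that Suc.hyps(2)] .
  moreover have "impulse_stage \<rho> M I z (Suc (k + j)) (I (\<rho> p' r)) (t + \<tau> + r)"
    if "j = 0" "p' = \<rho> p (t - s)" "\<tau> = 0"
  proof -
    have lt: "ereal (t - s) < hit_time \<rho> M p"
      using Suc.prems(3) by (cases "hit_time \<rho> M p") auto
    have "hit_time \<rho> M p = ereal (t - s + r)"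
      using hit_time_flow[OF _ lt] Suc.prems(2) Suc.hyps(2) that by simp
    from impulse_stage.Suc[OF Suc.prems(1) this] show ?thesis
      using Suc.prems(2) Suc.hyps(2) that by (auto simp: flow_add hit_time_eq_ereal_iff)
  qed
  ultimately show ?case using Suc.IH[OF Suc.prems] by (auto simp: add.assoc)
qed

text \<open>Hits within the compact window from \<delta> to \<open>T\<close> cannot disappear in the
  limit. The bound \<delta> stops hits from escaping to time 0, as can happen when \<open>q\<close>
  lies in \<open>M\<close>.\<close>

lemma hit_time_lower_semicontinuous:
  assumes "(w \<longlongrightarrow> q) F" "\<forall>\<^sub>F n in F. ereal \<delta> \<le> hit_time \<rho> M (w n)" "0 < \<delta>"
    and "ereal T < hit_time \<rho> M q"
  shows "\<forall>\<^sub>F n in F. ereal T < hit_time \<rho> M (w n)"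
proof (cases "T < \<delta>")
  case True
  from assms(2) show ?thesis
    by eventually_elim (use True less_le_trans[of "ereal T" "ereal \<delta>"] in auto)
next
  case False
  then have "q \<notin> past \<rho> M {\<delta>..T}"
    using less_hit_time_iff[of T q] assms(3,4) by (auto simp: mem_past_iff)
  moreover have "closed (past \<rho> M {\<delta>..T})"
    using assms(3) closed_impulsive_set by (intro closed_past) auto
  ultimately have "\<forall>\<^sub>F n in F. w n \<notin> past \<rho> M {\<delta>..T}"
    using assms(1) by (intro tendsto_eventually_notin_closed)
  with assms(2) show ?thesis
  proof eventually_elim
    case (elim n)
    have "\<rho> (w n) r \<notin> M" if "0 < r" "r \<le> T" for r
    proof (cases "r < \<delta>")
      case True
      then have "ereal r < hit_time \<rho> M (w n)"
        using elim(1) less_le_trans[of "ereal r" "ereal \<delta>"] by auto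
      then show ?thesis using less_hit_time_iff[of r] that(1) by auto
    next
      case False
      then show ?thesis using elim(2) that by (auto simp: mem_past_iff)
    qed
    then show ?case using False assms(3) by (subst less_hit_time_iff) auto
  qed
qed

text \<open>The orbit of \<open>q\<close> misses \<open>M\<close> on a closed time interval that
  contains 0, so \<open>q\<close> is outside a closed past of \<open>M\<close>, and so are all
  nearby points.\<close>

lemma hit_time_bounded_below_off_impulsive_set:
  assumes "(w \<longlongrightarrow> q) F" "q \<notin> M"
  shows "\<exists>\<delta>>0. \<forall>\<^sub>F n in F. ereal \<delta> \<le> hit_time \<rho> M (w n)"
proof -
  obtain \<delta> where \<delta>: "\<delta> > 0" "\<And>s. 0 < s \<Longrightarrow> s < \<delta> \<Longrightarrow> \<rho> q s \<notin> M"
    using eventually_off_impulsive_set[of q] by auto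
  have "\<rho> q s \<notin> M" if "0 \<le> s" "s \<le> \<delta>/2" for s
    using \<delta> that assms(2) by (cases "s = 0") (auto simp: flow_zero)
  then have "q \<notin> past \<rho> M {0..\<delta>/2}" by (auto simp: mem_past_iff)
  moreover have "closed (past \<rho> M {0..\<delta>/2})"
    using closed_impulsive_set by (intro closed_past) auto
  ultimately have "\<forall>\<^sub>F n in F. w n \<notin> past \<rho> M {0..\<delta>/2}"
    using assms(1) by (intro tendsto_eventually_notin_closed)
  then have "\<forall>\<^sub>F n in F. ereal (\<delta>/2) \<le> hit_time \<rho> M (w n)"
  proof eventually_elim
    case (elim n)
    then have "ereal (\<delta>/2) < hit_time \<rho> M (w n)"
      using \<delta>(1) by (subst less_hit_time_iff) (auto simp: mem_past_iff)
    then show ?case by simp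
  qed
  then show ?thesis using \<delta>(1) by (intro exI[of _ "\<delta>/2"]) auto
qed

end

section \<open>Continuity of hitting times and of impulse stages\<close>

context standing_impulsive_system
begin

text \<open>
  The tube at the hitting point forces nearby orbits to cross \<open>M\<close>: just before that point they
  lie in the tube at a level strictly above \<open>\<kappa>\<close>, the level of \<open>M\<close>, and the
  level decreases at unit speed along the flow.
\<close>

lemma hit_time_upper_semicontinuous:
  assumes w: "(w \<longlongrightarrow> q) F" and "hit_time \<rho> M q < ereal T"
  shows "\<forall>\<^sub>F n in F. hit_time \<rho> M (w n) < ereal T"
proof -
  obtain s where s: "hit_time \<rho> M q = ereal s" "s < T"
    using assms(2) hit_time_pos[of q] by (cases "hit_time \<rho> M q") auto
  have s': "0 < s" "\<rho> q s \<in> M" using s(1) by (auto simp: hit_time_eq_ereal_iff)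
  obtain \<kappa> S L where tube: "\<kappa> > 0" "closed S" "closed L" "\<rho> q s \<in> S" "past \<rho> L {\<kappa>} = S"
    "\<rho> q s \<in> interior (past \<rho> L {0..2 * \<kappa>})"
    "\<And>\<mu> \<nu>. 0 \<le> \<mu> \<Longrightarrow> \<mu> < \<nu> \<Longrightarrow> \<nu> \<le> 2 * \<kappa> \<Longrightarrow> past \<rho> L {\<mu>} \<inter> past \<rho> L {\<nu>} = {}"
    "S = M \<inter> past \<rho> L {0..2 * \<kappa>}"
    using strong_tube[OF s'(2)] unfolding strong_tube_condition_def by auto
  have "((\<lambda>\<eta>. \<rho> q (s - \<eta>)) \<longlongrightarrow> \<rho> q (s - 0)) (at_right 0)"
  proof (rule tendsto_flow)
    show "\<forall>\<^sub>F \<eta> in at_right 0. 0 \<le> s - \<eta>"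
      using s'(1) by (auto simp: eventually_at_right_field intro!: exI[of _ s])
  qed (use s' in \<open>auto intro!: tendsto_eq_intros\<close>)
  then have "\<forall>\<^sub>F \<eta> in at_right 0. \<rho> q (s - \<eta>) \<in> interior (past \<rho> L {0..2 * \<kappa>})"
    using tube(6) by (intro topological_tendstoD) auto
  then obtain d where d: "d > 0"
    "\<And>\<eta>. 0 < \<eta> \<Longrightarrow> \<eta> < d \<Longrightarrow> \<rho> q (s - \<eta>) \<in> interior (past \<rho> L {0..2 * \<kappa>})"
    unfolding eventually_at_right_field by auto
  \<comment> \<open>Here \<eta> < \<open>d\<close> keeps the point in the tube, \<eta> <
    \<open>s\<close> keeps its time positive, \<eta> \<le> \<kappa> keeps its level \<kappa> +
    \<eta> within 2\<kappa>, and \<open>s\<close> + \<eta> \<le> \<open>T\<close> leaves room for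
    late crossings.\<close>
  define \<eta> where "\<eta> = min (min (d/2) (s/2)) (min \<kappa> (T - s))"
  have \<eta>: "0 < \<eta>" "\<eta> < d" "\<eta> < s" "\<eta> \<le> \<kappa>" "s + \<eta> \<le> T"
    using d(1) s' s(2) tube(1) unfolding \<eta>_def by (auto simp: min_def)
  define a where "a = \<rho> q (s - \<eta>)"
  have lim: "((\<lambda>n. \<rho> (w n) (s - \<eta>)) \<longlongrightarrow> a) F"
    unfolding a_def using \<eta> w by (intro tendsto_flow) auto
  have "\<rho> (\<rho> q s) \<kappa> \<in> L" using tube(4,5) by (auto simp: mem_past_iff)
  then have "\<rho> a (\<kappa> + \<eta>) \<in> L"
    unfolding a_def using \<eta> tube(1) s' by (simp add: flow_add add.commute)
  then have a: "a \<in> past \<rho> L {\<kappa> + \<eta>}" by (auto simp: mem_past_iff)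
  have disj: "\<rho> a \<mu> \<notin> L" if "0 \<le> \<mu>" "\<mu> \<le> 2 * \<kappa>" "\<mu> \<noteq> \<kappa> + \<eta>" for \<mu>
  proof
    assume "\<rho> a \<mu> \<in> L"
    then have "a \<in> past \<rho> L {\<mu>}" by (auto simp: mem_past_iff)
    with a that \<eta> tube(1) tube(7)[of \<mu> "\<kappa> + \<eta>"] tube(7)[of "\<kappa> + \<eta>" \<mu>] show False
      by (cases "\<mu> < \<kappa> + \<eta>") auto
  qed
  have "\<forall>\<^sub>F n in F. \<rho> (w n) (s - \<eta>) \<in> interior (past \<rho> L {0..2 * \<kappa>})"
    using d(2)[OF \<eta>(1,2)] lim unfolding a_def by (intro topological_tendstoD) auto
  \<comment> \<open>Levels are unique by disjointness, so \<open>a\<close> has only the level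
    \<kappa> + \<eta>. The levels outside the open interval from \<kappa> to \<kappa> + 2\<eta> form
    a compact set, and nearby points avoid them too.\<close>
  moreover have "\<forall>\<^sub>F n in F. \<rho> (w n) (s - \<eta>) \<notin> past \<rho> L ({0..\<kappa>} \<union> {\<kappa> + 2 * \<eta>..2 * \<kappa>})"
  proof (rule tendsto_eventually_notin_closed[OF lim])
    show "closed (past \<rho> L ({0..\<kappa>} \<union> {\<kappa> + 2 * \<eta>..2 * \<kappa>}))"
      using tube(1,3) \<eta>(1) by (intro closed_past compact_Un) auto
    show "a \<notin> past \<rho> L ({0..\<kappa>} \<union> {\<kappa> + 2 * \<eta>..2 * \<kappa>})"
      using disj tube(1) \<eta>(1) by (auto simp: mem_past_iff)
  qed
  ultimately show ?thesis
  proof eventually_elim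
    case (elim n)
    define b where "b = \<rho> (w n) (s - \<eta>)"
    have "b \<in> past \<rho> L {0..2 * \<kappa>}" using elim(1) interior_subset unfolding b_def by blast
    then obtain \<mu> where \<mu>: "0 \<le> \<mu>" "\<mu> \<le> 2 * \<kappa>" "\<rho> b \<mu> \<in> L" by (auto simp: mem_past_iff)
    have \<mu>': "\<kappa> < \<mu>" "\<mu> < \<kappa> + 2 * \<eta>"
      using elim(2) \<mu> unfolding b_def[symmetric] by (auto simp: mem_past_iff not_le[symmetric])
    have "\<rho> (\<rho> b (\<mu> - \<kappa>)) \<kappa> \<in> L" using \<mu> \<mu>' tube(1) by (simp add: flow_add)
    then have "\<rho> b (\<mu> - \<kappa>) \<in> past \<rho> L {\<kappa>}" by (auto simp: mem_past_iff)
    then have "\<rho> b (\<mu> - \<kappa>) \<in> M" using tube(5,8) by blast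
    then have hit: "\<rho> (w n) (s - \<eta> + (\<mu> - \<kappa>)) \<in> M"
      unfolding b_def using \<eta> \<mu>' by (simp add: flow_add)
    \<comment> \<open>The crossing happens when the level has dropped from \<mu> to \<kappa>; this
      time differs from \<open>s\<close> by less than \<eta>.\<close>
    define r where "r = s - \<eta> + (\<mu> - \<kappa>)"
    have r: "0 < r" "r < T" using \<eta> \<mu>' unfolding r_def by auto
    then have "\<not> ereal r < hit_time \<rho> M (w n)"
      using hit less_hit_time_iff[of r] unfolding r_def[symmetric] by auto
    then show ?case using r(2) by (meson le_less_trans less_ereal.simps(1) not_le)
  qed
qed

lemma hit_time_tendsto:
  assumes "(w \<longlongrightarrow> q) F" "\<forall>\<^sub>F n in F. ereal \<delta> \<le> hit_time \<rho> M (w n)" "0 < \<delta>"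
  shows "((\<lambda>n. hit_time \<rho> M (w n)) \<longlongrightarrow> hit_time \<rho> M q) F"
proof (rule order_tendstoI)
  fix b assume "b < hit_time \<rho> M q"
  then obtain T where T: "b < ereal T" "ereal T < hit_time \<rho> M q" using ereal_dense2 by blast
  from hit_time_lower_semicontinuous[OF assms T(2)]
  show "\<forall>\<^sub>F n in F. b < hit_time \<rho> M (w n)"
    by eventually_elim (use T(1) in auto)
next
  fix b assume "hit_time \<rho> M q < b"
  then obtain T where T: "hit_time \<rho> M q < ereal T" "ereal T < b" using ereal_dense2 by blast
  from hit_time_upper_semicontinuous[OF assms(1) T(1)]
  show "\<forall>\<^sub>F n in F. hit_time \<rho> M (w n) < b"
    by eventually_elim (use T(2) in auto)
qed

lemma impulse_notin: "p \<in> M \<Longrightarrow> I p \<notin> M"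
  using impulse_leaves by auto

text \<open>\<open>I\<close> is continuous only on \<open>M\<close>, so the limit point and
  eventually all approximating points must lie there. The case \<open>t = 0\<close> covers hits at
  times shrinking to 0.\<close>

lemma tendsto_impulse_hit:
  assumes "(w \<longlongrightarrow> q) F" "(\<tau> \<longlongrightarrow> t) F" "0 \<le> t" "\<rho> q t \<in> M"
    and "\<forall>\<^sub>F n in F. hit_time \<rho> M (w n) = ereal (\<tau> n)"
  shows "((\<lambda>n. I (\<rho> (w n) (\<tau> n))) \<longlongrightarrow> I (\<rho> q t)) F"
proof (rule continuous_on_tendsto_compose[OF continuous_impulse])
  show "((\<lambda>n. \<rho> (w n) (\<tau> n)) \<longlongrightarrow> \<rho> q t) F"
    using assms(5) by (intro tendsto_flow assms(1-3)) (auto elim!: eventually_mono simp: hit_time_eq_ereal_iff)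
  show "\<forall>\<^sub>F n in F. \<rho> (w n) (\<tau> n) \<in> M"
    using assms(5) by (auto elim!: eventually_mono simp: hit_time_eq_ereal_iff)
qed (fact assms)

text \<open>Induction over the impulses. The lower bound on hitting times is assumed only at the
  start: each impulse ends off \<open>M\<close>, where a new bound \<delta>' is available near the
  limit point.\<close>

lemma impulse_stage_tendsto:
  assumes "impulse_stage \<rho> M I q k p s" "(w \<longlongrightarrow> q) F"
    and "\<forall>\<^sub>F n in F. ereal \<delta> \<le> hit_time \<rho> M (w n)" "0 < \<delta>"
  shows "\<exists>P S \<delta>'. (\<forall>\<^sub>F n in F. impulse_stage \<rho> M I (w n) k (P n) (S n)) \<and> (P \<longlongrightarrow> p) F
    \<and> (S \<longlongrightarrow> s) F \<and> 0 < \<delta>' \<and> (\<forall>\<^sub>F n in F. ereal \<delta>' \<le> hit_time \<rho> M (P n))"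
  using assms
proof (induction)
  case zero
  then show ?case by (intro exI[of _ w] exI[of _ "\<lambda>_. 0"] exI[of _ \<delta>]) (auto intro!: always_eventually impulse_stage.zero)
next
  case (Suc k p s r)
  from Suc.IH[OF Suc.prems] obtain P S \<delta>' where PS:
    "\<forall>\<^sub>F n in F. impulse_stage \<rho> M I (w n) k (P n) (S n)" "(P \<longlongrightarrow> p) F" "(S \<longlongrightarrow> s) F"
    "0 < \<delta>'" "\<forall>\<^sub>F n in F. ereal \<delta>' \<le> hit_time \<rho> M (P n)" by blast
  \<comment> \<open>\<open>real_of_ereal\<close> has a default value at infinity; upper
    semicontinuity makes the hitting times of \<open>P n\<close> finite eventually, so it does no
    harm.\<close>
  define R where "R = (\<lambda>n. real_of_ereal (hit_time \<rho> M (P n)))"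
  have r: "0 < r" "\<rho> p r \<in> M" using Suc.hyps(2) by (auto simp: hit_time_eq_ereal_iff)
  have R: "(R \<longlongrightarrow> r) F"
    using hit_time_tendsto[OF PS(2,5,4)] Suc.hyps(2) unfolding R_def by simp
  have "\<forall>\<^sub>F n in F. hit_time \<rho> M (P n) < ereal (r + 1)"
    using hit_time_upper_semicontinuous[OF PS(2)] Suc.hyps(2) by simp
  then have hitR: "\<forall>\<^sub>F n in F. hit_time \<rho> M (P n) = ereal (R n)"
  proof eventually_elim
    case (elim n)
    then show ?case using hit_time_pos[of "P n"] unfolding R_def
      by (cases "hit_time \<rho> M (P n)") auto
  qed
  have lim: "((\<lambda>n. I (\<rho> (P n) (R n))) \<longlongrightarrow> I (\<rho> p r)) F"
    using r by (intro tendsto_impulse_hit PS R hitR) auto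
  from hit_time_bounded_below_off_impulsive_set[OF this impulse_notin[OF r(2)]]
  obtain \<delta>'' where "0 < \<delta>''" "\<forall>\<^sub>F n in F. ereal \<delta>'' \<le> hit_time \<rho> M (I (\<rho> (P n) (R n)))" by blast
  moreover have "\<forall>\<^sub>F n in F. impulse_stage \<rho> M I (w n) (Suc k) (I (\<rho> (P n) (R n))) (S n + R n)"
    using PS(1) hitR by eventually_elim (rule impulse_stage.Suc)
  ultimately show ?case using lim tendsto_add[OF PS(3) R]
    by (intro exI[of _ "\<lambda>n. I (\<rho> (P n) (R n))"] exI[of _ "\<lambda>n. S n + R n"] exI[of _ \<delta>'']) auto
qed

section \<open>The semigroup law and continuity of impulsive trajectories\<close>

lemma trajectory_eqI:
  assumes "impulse_stage \<rho> M I z n p s" "s \<le> t" "ereal t < ereal s + hit_time \<rho> M p"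
  shows "impulsive_trajectory \<rho> M I z t = \<rho> p (t - s)"
proof -
  have "0 \<le> t" using impulse_stage_nonneg[OF assms(1)] assms(2) by simp
  moreover have "impulsive_graph \<rho> M I z t (\<rho> p (t - s))"
    unfolding impulsive_graph_def using assms by blast
  ultimately show ?thesis by (simp add: impulsive_trajectory_eq_iff)
qed

lemma trajectory_stageE:
  assumes "0 \<le> t"
  obtains k p s where "impulse_stage \<rho> M I z k p s" "s \<le> t" "ereal t < ereal s + hit_time \<rho> M p"
    "impulsive_trajectory \<rho> M I z t = \<rho> p (t - s)"
proof -
  from trajectory_defined[OF assms, of z] obtain k p s where
    "impulse_stage \<rho> M I z k p s" "s \<le> t" "ereal t < ereal s + hit_time \<rho> M p"
    unfolding impulsive_graph_def by blast
  with trajectory_eqI[OF this] show thesis by (intro that)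
qed

lemma trajectory_zero: "impulsive_trajectory \<rho> M I z 0 = z"
  using trajectory_eqI[OF impulse_stage.zero, of 0 z] hit_time_pos[of z] flow_zero
  by (simp add: zero_ereal_def)

lemma trajectory_add:
  assumes "0 \<le> t" "0 \<le> u"
  shows "impulsive_trajectory \<rho> M I (impulsive_trajectory \<rho> M I z t) u
    = impulsive_trajectory \<rho> M I z (t + u)"
proof -
  obtain k p s where 1: "impulse_stage \<rho> M I z k p s" "s \<le> t" "ereal t < ereal s + hit_time \<rho> M p"
    "impulsive_trajectory \<rho> M I z t = \<rho> p (t - s)"
    using trajectory_stageE[OF assms(1)] by blast
  define q where "q = \<rho> p (t - s)"
  obtain j p' \<tau> where 2: "impulse_stage \<rho> M I q j p' \<tau>" "\<tau> \<le> u" "ereal u < ereal \<tau> + hit_time \<rho> M p'"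
    "impulsive_trajectory \<rho> M I q u = \<rho> p' (u - \<tau>)"
    using trajectory_stageE[OF assms(2)] by blast
  from impulse_stage_shift[OF 2(1)[unfolded q_def] 1(1,2,3)]
  have "impulsive_trajectory \<rho> M I z (t + u) = \<rho> p' (u - \<tau>)"
  proof
    assume a: "j = 0 \<and> p' = \<rho> p (t - s) \<and> \<tau> = 0"
    have lt: "ereal (t - s) < hit_time \<rho> M p"
      using 1(3) by (cases "hit_time \<rho> M p") auto
    have "ereal s + hit_time \<rho> M p = ereal t + hit_time \<rho> M p'"
      using hit_time_flow[OF _ lt] 1(2) a
      by (cases "hit_time \<rho> M p"; cases "hit_time \<rho> M p'") auto
    then have "ereal (t + u) < ereal s + hit_time \<rho> M p"
      using 2(3) a by (cases "hit_time \<rho> M p'") auto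
    from trajectory_eqI[OF 1(1) _ this] show ?thesis
      using a 1(2) assms(2) by (simp add: flow_add algebra_simps)
  next
    assume "impulse_stage \<rho> M I z (k + j) p' (t + \<tau>)"
    from trajectory_eqI[OF this, of "t + u"] 2(2,3) show ?thesis
      by (cases "hit_time \<rho> M p'") auto
  qed
  then show ?thesis using 1(4) 2(4) unfolding q_def by simp
qed

text \<open>At an impulse time the trajectory already has its value after the jump, so from
  \<open>t\<close> up to the next impulse it is a single arc of the flow.\<close>

lemma trajectory_right_continuous:
  assumes "0 \<le> t" "(T \<longlongrightarrow> t) F" "\<forall>\<^sub>F k in F. t \<le> T k"
  shows "((\<lambda>k. impulsive_trajectory \<rho> M I z (T k)) \<longlongrightarrow> impulsive_trajectory \<rho> M I z t) F"
proof -
  obtain j p s where 1: "impulse_stage \<rho> M I z j p s" "s \<le> t" "ereal t < ereal s + hit_time \<rho> M p"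
    "impulsive_trajectory \<rho> M I z t = \<rho> p (t - s)"
    using trajectory_stageE[OF assms(1)] by blast
  have "((\<lambda>k. ereal (T k)) \<longlongrightarrow> ereal t) F" using assms(2) by simp
  from order_tendstoD(2)[OF this 1(3)] assms(3)
  have "\<forall>\<^sub>F k in F. \<rho> p (T k - s) = impulsive_trajectory \<rho> M I z (T k)"
  proof eventually_elim
    case (elim k)
    then show ?case using trajectory_eqI[OF 1(1), of "T k"] 1(2) by simp
  qed
  moreover have "((\<lambda>k. \<rho> p (T k - s)) \<longlongrightarrow> \<rho> p (t - s)) F"
    using 1(2) assms(2,3)
    by (intro tendsto_flow tendsto_intros) (auto elim!: eventually_mono)
  ultimately show ?thesis unfolding 1(4) by (rule Lim_transform_eventually[rotated])
qed

text \<open>Away from the impulse times of \<open>q\<close>, nearby trajectories have made the same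
  number of impulses by time \<open>t\<close>. At an impulse time they could still be on the arc
  before the jump. Time 0 counts as stage 0 and is excluded as well.\<close>

lemma trajectory_tendsto:
  assumes "(w \<longlongrightarrow> q) F" "\<forall>\<^sub>F n in F. ereal \<delta> \<le> hit_time \<rho> M (w n)" "0 < \<delta>" "0 \<le> t"
    and "\<And>k p. \<not> impulse_stage \<rho> M I q k p t"
  shows "((\<lambda>n. impulsive_trajectory \<rho> M I (w n) t) \<longlongrightarrow> impulsive_trajectory \<rho> M I q t) F"
proof -
  obtain k p s where 1: "impulse_stage \<rho> M I q k p s" "s \<le> t" "ereal t < ereal s + hit_time \<rho> M p"
    "impulsive_trajectory \<rho> M I q t = \<rho> p (t - s)"
    using trajectory_stageE[OF assms(4)] by blast
  have "s < t" using 1(1,2) assms(5) by (cases "s = t") auto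
  obtain P S \<delta>' where PS:
    "\<forall>\<^sub>F n in F. impulse_stage \<rho> M I (w n) k (P n) (S n)" "(P \<longlongrightarrow> p) F" "(S \<longlongrightarrow> s) F"
    "0 < \<delta>'" "\<forall>\<^sub>F n in F. ereal \<delta>' \<le> hit_time \<rho> M (P n)"
    using impulse_stage_tendsto[OF 1(1) assms(1-3)] by blast
  have "ereal (t - s) < hit_time \<rho> M p"
    using 1(3) by (cases "hit_time \<rho> M p") auto
  \<comment> \<open>The margin \<open>T\<close> absorbs the error in \<open>S n\<close>: once
    \<open>t - T < S n\<close>, the time \<open>t\<close> precedes the next impulse of
    \<open>w n\<close>.\<close>
  then obtain T where T: "ereal (t - s) < ereal T" "ereal T < hit_time \<rho> M p"
    using ereal_dense2 by blast
  have St: "\<forall>\<^sub>F n in F. S n < t" using order_tendstoD(2)[OF PS(3) \<open>s < t\<close>] .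
  have "\<forall>\<^sub>F n in F. t - T < S n" using order_tendstoD(1)[OF PS(3), of "t - T"] T(1) by simp
  with PS(1) St hit_time_lower_semicontinuous[OF PS(2,5,4) T(2)]
  have "\<forall>\<^sub>F n in F. \<rho> (P n) (t - S n) = impulsive_trajectory \<rho> M I (w n) t"
  proof eventually_elim
    case (elim n)
    then show ?case using trajectory_eqI[OF elim(1), of t]
      by (cases "hit_time \<rho> M (P n)") auto
  qed
  moreover have "((\<lambda>n. \<rho> (P n) (t - S n)) \<longlongrightarrow> \<rho> p (t - s)) F"
    using 1(2) St by (intro tendsto_flow tendsto_intros PS) (auto elim!: eventually_mono)
  ultimately show ?thesis unfolding 1(4) by (rule Lim_transform_eventually[rotated])
qed

text \<open>
  If the hitting times were not bounded below, a subsequence of the \<open>u n\<close> would jump almost at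
  once to points close to \<open>I p\<close>, so \<open>g k\<close> would also tend to \<open>I p \<noteq> p\<close>.
\<close>

lemma hit_time_bounded_below_if_limits_return:
  fixes u :: "nat \<Rightarrow> 'a" and T :: "nat \<Rightarrow> real"
  assumes u: "u \<longlonglongrightarrow> p"
    and T: "T \<longlonglongrightarrow> 0" "\<And>k. 0 < T k"
    and g: "\<And>k. (\<lambda>n. impulsive_trajectory \<rho> M I (u n) (T k)) \<longlonglongrightarrow> g k" "g \<longlonglongrightarrow> p"
  shows "\<exists>\<delta>>0. \<forall>\<^sub>F n in sequentially. ereal \<delta> \<le> hit_time \<rho> M (u n)"
proof (rule ccontr)
  assume "\<not> ?thesis"
  then have *: "\<exists>m\<ge>n. hit_time \<rho> M (u m) < ereal \<delta>" if "0 < \<delta>" for n \<delta>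
    using that unfolding eventually_sequentially by (meson not_le)
  have "\<exists>m\<ge>n. hit_time \<rho> M (u m) < ereal (inverse (real (Suc n)))" for n
    by (rule *) simp
  \<comment> \<open>\<open>r\<close> need not be increasing; \<open>n \<le> r n\<close> suffices for
    passing to limits along it.\<close>
  then obtain r where r: "\<And>n. n \<le> r n" "\<And>n. hit_time \<rho> M (u (r n)) < ereal (inverse (real (Suc n)))"
    by metis
  define \<tau> where "\<tau> = (\<lambda>n. real_of_ereal (hit_time \<rho> M (u (r n))))"
  have hit: "hit_time \<rho> M (u (r n)) = ereal (\<tau> n)" for n
    unfolding \<tau>_def using r(2)[of n] hit_time_pos[of "u (r n)"]
    by (cases "hit_time \<rho> M (u (r n))") auto
  have \<tau>: "0 < \<tau> n" "\<rho> (u (r n)) (\<tau> n) \<in> M" "\<tau> n < inverse (real (Suc n))" for n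
    using hit[of n, unfolded hit_time_eq_ereal_iff] r(2)[of n, unfolded hit] by simp_all
  have \<tau>0: "\<tau> \<longlonglongrightarrow> 0"
    by (rule tendsto_sandwich[OF _ _ tendsto_const LIMSEQ_inverse_real_of_nat])
       (auto intro!: always_eventually less_imp_le \<tau>(1) \<tau>(3)[unfolded of_nat_Suc])
  have rtop: "filterlim r at_top sequentially"
    using r(1) by (intro filterlim_at_top_mono[OF filterlim_ident]) auto
  have ur: "(\<lambda>n. u (r n)) \<longlonglongrightarrow> p" using filterlim_compose[OF u rtop] .
  have "(\<lambda>n. \<rho> (u (r n)) (\<tau> n)) \<longlonglongrightarrow> \<rho> p 0"
    using \<tau>(1) by (intro tendsto_flow ur \<tau>0) (auto intro!: always_eventually less_imp_le)
  \<comment> \<open>The hit points lie in the closed set \<open>M\<close> and, their hitting times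
    shrinking to 0, tend to \<open>p\<close>.\<close>
  then have "p \<in> M"
    using closed_sequentially[OF closed_impulsive_set, of "\<lambda>n. \<rho> (u (r n)) (\<tau> n)" "\<rho> p 0"] \<tau>(2)
    by (simp add: flow_zero)
  define v where "v = (\<lambda>n. I (\<rho> (u (r n)) (\<tau> n)))"
  have v: "v \<longlonglongrightarrow> I p"
    using tendsto_impulse_hit[OF ur \<tau>0] hit \<open>p \<in> M\<close> unfolding v_def by (simp add: flow_zero)
  obtain \<delta> where \<delta>: "0 < \<delta>" "\<forall>\<^sub>F n in sequentially. ereal \<delta> \<le> hit_time \<rho> M (v n)"
    using hit_time_bounded_below_off_impulsive_set[OF v impulse_notin[OF \<open>p \<in> M\<close>]] by blast
  \<comment> \<open>For large \<open>n\<close> the first impulse comes before \<open>T k\<close>,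
    and the second one not before \<delta> more has passed. At time \<open>T k\<close> the
    trajectory is thus on the arc starting at \<open>v n\<close>.\<close>
  have gk: "g k = \<rho> (I p) (T k)" if "T k < \<delta>" for k
  proof (rule LIMSEQ_unique)
    show "(\<lambda>n. impulsive_trajectory \<rho> M I (u (r n)) (T k)) \<longlonglongrightarrow> g k"
      using filterlim_compose[OF g(1) rtop] .
    have small: "\<forall>\<^sub>F n in sequentially. \<tau> n < T k" using order_tendstoD(2)[OF \<tau>0 T(2)] .
    with \<delta>(2) have "\<forall>\<^sub>F n in sequentially.
      \<rho> (v n) (T k - \<tau> n) = impulsive_trajectory \<rho> M I (u (r n)) (T k)"
    proof eventually_elim
      case (elim n)
      have "impulse_stage \<rho> M I (u (r n)) (Suc 0) (v n) (0 + \<tau> n)"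
        unfolding v_def by (intro impulse_stage.intros hit)
      from trajectory_eqI[OF this, of "T k"] elim that \<tau>(1)[of n] show ?case
        by (cases "hit_time \<rho> M (v n)") auto
    qed
    moreover have "(\<lambda>n. \<rho> (v n) (T k - \<tau> n)) \<longlonglongrightarrow> \<rho> (I p) (T k - 0)"
      using small T(2)[of k] by (intro tendsto_flow tendsto_intros v \<tau>0) (auto elim!: eventually_mono)
    ultimately show "(\<lambda>n. impulsive_trajectory \<rho> M I (u (r n)) (T k)) \<longlonglongrightarrow> \<rho> (I p) (T k)"
      using Lim_transform_eventually by fastforce
  qed
  have "\<forall>\<^sub>F k in sequentially. \<rho> (I p) (T k) = g k"
    using order_tendstoD(2)[OF T(1) \<delta>(1)] by eventually_elim (simp add: gk)
  moreover have "(\<lambda>k. \<rho> (I p) (T k)) \<longlonglongrightarrow> \<rho> (I p) 0"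
    using T by (intro tendsto_flow tendsto_const) (auto intro!: always_eventually less_imp_le)
  ultimately have "g \<longlonglongrightarrow> I p" using Lim_transform_eventually flow_zero by fastforce
  then have "p = I p" using LIMSEQ_unique g(2) by blast
  then show False using \<open>p \<in> M\<close> impulse_notin by metis
qed

end

section \<open>Time sequences, limit sets and comparability\<close>

lemma filterlim_interleave:
  assumes "filterlim a F sequentially" "filterlim b F sequentially"
  shows "filterlim (\<lambda>n. if even n then a (n div 2) else b (n div 2)) F sequentially"
proof -
  have "filterlim (\<lambda>n::nat. n div 2) at_top sequentially"
    unfolding filterlim_at_top eventually_sequentially
  proof
    fix Z :: nat
    show "\<exists>N. \<forall>n\<ge>N. Z \<le> n div 2" by (intro exI[of _ "2 * Z"]) auto
  qed
  from filterlim_compose[OF assms(1) this] filterlim_compose[OF assms(2) this] show ?thesis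
    by (intro filterlim_If[OF filterlim_mono[OF _ order_refl inf_le1] filterlim_mono[OF _ order_refl inf_le1]])
qed

text \<open>For each \<open>n\<close> one time beyond \<open>n\<close> is picked at which both
  functions are within 1/(n+1) of their targets. Using the same time for both transfers convergence
  from \<open>f\<close> to \<open>g\<close>.\<close>

lemma ex_diagonal_times:
  fixes f :: "real \<Rightarrow> 'a::metric_space" and g :: "real \<Rightarrow> 'b::metric_space"
  assumes "\<And>n::nat. \<exists>t::nat \<Rightarrow> real. (\<forall>k. 0 \<le> t k) \<and> filterlim t at_top sequentially
    \<and> (\<lambda>k. f (t k)) \<longlonglongrightarrow> a n \<and> (\<lambda>k. g (t k)) \<longlonglongrightarrow> b n"
  obtains r :: "nat \<Rightarrow> real" where "\<And>n. 0 \<le> r n" "filterlim r at_top sequentially"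
    "(\<lambda>n. dist (f (r n)) (a n)) \<longlonglongrightarrow> 0" "(\<lambda>n. dist (g (r n)) (b n)) \<longlonglongrightarrow> 0"
proof -
  have "\<exists>s. 0 \<le> s \<and> real n \<le> s \<and> dist (f s) (a n) < inverse (real (Suc n))
      \<and> dist (g s) (b n) < inverse (real (Suc n))" for n
  proof -
    obtain t where t: "\<forall>k. 0 \<le> t k" "filterlim t at_top sequentially"
      "(\<lambda>k. f (t k)) \<longlonglongrightarrow> a n" "(\<lambda>k. g (t k)) \<longlonglongrightarrow> b n" using assms by blast
    have "\<forall>\<^sub>F k in sequentially. real n \<le> t k"
      using t(2) unfolding filterlim_at_top by blast
    moreover have "\<forall>\<^sub>F k in sequentially. dist (f (t k)) (a n) < inverse (real (Suc n))"
      using t(3) by (rule tendstoD) simp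
    moreover have "\<forall>\<^sub>F k in sequentially. dist (g (t k)) (b n) < inverse (real (Suc n))"
      using t(4) by (rule tendstoD) simp
    ultimately have "\<forall>\<^sub>F k in sequentially. real n \<le> t k
      \<and> dist (f (t k)) (a n) < inverse (real (Suc n)) \<and> dist (g (t k)) (b n) < inverse (real (Suc n))"
      by eventually_elim blast
    then show ?thesis using t(1) unfolding eventually_sequentially by blast
  qed
  then obtain r where r: "\<And>n. 0 \<le> r n" "\<And>n. real n \<le> r n"
    "\<And>n. dist (f (r n)) (a n) < inverse (real (Suc n))"
    "\<And>n. dist (g (r n)) (b n) < inverse (real (Suc n))" by metis
  show thesis
  proof
    show "filterlim r at_top sequentially"
      using r(2) by (intro filterlim_at_top_mono[OF filterlim_real_sequentially]) auto
    show "(\<lambda>n. dist (f (r n)) (a n)) \<longlonglongrightarrow> 0"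
      by (rule tendsto_sandwich[OF _ _ tendsto_const LIMSEQ_inverse_real_of_nat])
        (use r(3) in \<open>intro always_eventually allI less_imp_le zero_le_dist; simp\<close>)+
    show "(\<lambda>n. dist (g (r n)) (b n)) \<longlonglongrightarrow> 0"
      by (rule tendsto_sandwich[OF _ _ tendsto_const LIMSEQ_inverse_real_of_nat])
        (use r(4) in \<open>intro always_eventually allI less_imp_le zero_le_dist; simp\<close>)+
  qed (fact r(1))
qed

lemma tendsto_via_dist:
  fixes f g :: "_ \<Rightarrow> 'a::metric_space"
  assumes "((\<lambda>n. dist (f n) (g n)) \<longlongrightarrow> 0) F" "(g \<longlongrightarrow> l) F"
  shows "(f \<longlongrightarrow> l) F"
proof -
  have "((\<lambda>n. dist (g n) l) \<longlongrightarrow> 0) F"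
    using assms(2) by (rule tendsto_dist_iff[THEN iffD1])
  from tendsto_add[OF assms(1) this]
  have *: "((\<lambda>n. dist (f n) (g n) + dist (g n) l) \<longlongrightarrow> 0) F" by simp
  have "((\<lambda>n. dist (f n) l) \<longlongrightarrow> 0) F"
    by (rule tendsto_sandwich[OF always_eventually always_eventually tendsto_const *])
      (simp_all add: dist_triangle)
  then show ?thesis by (rule tendsto_dist_iff[THEN iffD2])
qed

lemma positive_limit_set_iff: "q \<in> positive_limit_set \<rho> M I z \<longleftrightarrow> limit_times \<rho> M I z q \<noteq> {}"
  unfolding positive_limit_set_def limit_times_def by auto

text \<open>A diagonal argument in which both functions are the same trajectory. It yields
  membership in the limit set at impulse times, which are approached from the right.\<close>

lemma closed_positive_limit_set: "closed (positive_limit_set \<rho> M I z)"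
  unfolding closed_sequential_limits
proof (intro allI impI, elim conjE)
  fix q l assume q: "\<forall>n. q n \<in> positive_limit_set \<rho> M I z" "q \<longlonglongrightarrow> l"
  define f where "f = impulsive_trajectory \<rho> M I z"
  have "\<exists>t. (\<forall>k. 0 \<le> t k) \<and> filterlim t at_top sequentially
      \<and> (\<lambda>k. f (t k)) \<longlonglongrightarrow> q n \<and> (\<lambda>k. f (t k)) \<longlonglongrightarrow> q n" for n
    using q(1) unfolding positive_limit_set_def f_def by auto
  then obtain r where "\<And>n. 0 \<le> r n" "filterlim r at_top sequentially"
    "(\<lambda>n. dist (f (r n)) (q n)) \<longlonglongrightarrow> 0"
    by (rule ex_diagonal_times[of f q f q]) blast
  then show "l \<in> positive_limit_set \<rho> M I z"
    using tendsto_via_dist[OF _ q(2), of "\<lambda>n. f (r n)"]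
    unfolding positive_limit_set_def f_def by blast
qed

text \<open>
  Interleaving two sequences of \<open>limit_times\<close> gives a third one, so all of
  them produce the same limit in the second system.
\<close>

lemma comparable_imp_ex_limit:
  assumes "comparable \<sigma> MY IY y \<pi> MX IX x K" "q \<in> K"
  shows "\<exists>p. limit_times \<pi> MX IX x q \<subseteq> limit_times \<sigma> MY IY y p"
proof (cases "limit_times \<pi> MX IX x q = {}")
  case False
  have sub: "\<exists>p. t \<in> limit_times \<sigma> MY IY y p" if "t \<in> limit_times \<pi> MX IX x q" for t
    using assms that unfolding comparable_def limit_times_in_def by blast
  define g where "g = impulsive_trajectory \<sigma> MY IY y"
  from False obtain s p where s: "s \<in> limit_times \<pi> MX IX x q" "s \<in> limit_times \<sigma> MY IY y p"
    using sub by blast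
  have "t \<in> limit_times \<sigma> MY IY y p" if t: "t \<in> limit_times \<pi> MX IX x q" for t
  proof -
    obtain p' where p': "t \<in> limit_times \<sigma> MY IY y p'" using sub t by blast
    define u where "u = (\<lambda>n. if even n then s (n div 2) else t (n div 2))"
    have "u \<in> limit_times \<pi> MX IX x q"
      using s(1) t filterlim_interleave[of s at_top t]
        filterlim_interleave[of "\<lambda>n. impulsive_trajectory \<pi> MX IX x (s n)" "nhds q"
          "\<lambda>n. impulsive_trajectory \<pi> MX IX x (t n)"]
      unfolding limit_times_def u_def by (simp add: if_distrib[of "impulsive_trajectory \<pi> MX IX x"])
    then obtain p'' where "(\<lambda>n. g (u n)) \<longlonglongrightarrow> p''"
      using sub unfolding limit_times_def g_def by blast
    then have lim: "((\<lambda>n. g (u n)) \<circ> (\<lambda>n. 2 * n)) \<longlonglongrightarrow> p''" "((\<lambda>n. g (u n)) \<circ> (\<lambda>n. 2 * n + 1)) \<longlonglongrightarrow> p''"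
      by (auto intro!: LIMSEQ_subseq_LIMSEQ strict_monoI)
    have "(\<lambda>n. g (s n)) \<longlonglongrightarrow> p''" "(\<lambda>n. g (t n)) \<longlonglongrightarrow> p''"
      using lim unfolding u_def o_def by simp_all
    moreover have "(\<lambda>n. g (s n)) \<longlonglongrightarrow> p" "(\<lambda>n. g (t n)) \<longlonglongrightarrow> p'"
      using s(2) p' unfolding limit_times_def g_def by simp_all
    ultimately have "p = p'" by (metis LIMSEQ_unique)
    then show ?thesis using p' by simp
  qed
  then show ?thesis by blast
qed simp

section \<open>Construction of the map and its conjugacy property\<close>

theorem theorem4p8:
  fixes \<pi> :: "'x::metric_space \<Rightarrow> real \<Rightarrow> 'x" and MX :: "'x set" and IX :: "'x \<Rightarrow> 'x"
    and \<sigma> :: "'y::metric_space \<Rightarrow> real \<Rightarrow> 'y" and MY :: "'y set" and IY :: "'y \<Rightarrow> 'y"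
    and x :: 'x and y :: 'y and A :: "'x set"
  defines "K \<equiv> positive_limit_set \<pi> MX IX x \<inter> A"
  assumes "standing_impulsive_system \<pi> MX IX"
    and "standing_impulsive_system \<sigma> MY IY"
    and "positively_invariant \<pi> MX IX (A - MX)"
    and "K \<noteq> {}"
    and "comparable \<sigma> MY IY y \<pi> MX IX x K"
  shows "\<exists>h. continuous_on K h \<and> h ` K \<subseteq> positive_limit_set \<sigma> MY IY y
    \<and> (\<forall>q\<in>K. limit_times \<pi> MX IX x q \<subseteq> limit_times \<sigma> MY IY y (h q))
    \<and> (\<forall>q\<in>K - MX. \<forall>t\<ge>0. impulsive_trajectory \<pi> MX IX q t \<in> K
        \<and> h (impulsive_trajectory \<pi> MX IX q t) = impulsive_trajectory \<sigma> MY IY (h q) t)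
    \<and> (impulse_invariant MX IX K \<longrightarrow>
        (\<forall>q\<in>K \<inter> MX. \<forall>t\<ge>0. impulsive_trajectory \<pi> MX IX (IX q) t \<in> K
          \<and> h (impulsive_trajectory \<pi> MX IX (IX q) t)
              = impulsive_trajectory \<sigma> MY IY (h (IX q)) t))"
proof -
  interpret X: standing_impulsive_system \<pi> MX IX by fact
  interpret Y: standing_impulsive_system \<sigma> MY IY by fact
  define f where "f = impulsive_trajectory \<pi> MX IX"
  define g where "g = impulsive_trajectory \<sigma> MY IY"
  define LX where "LX = limit_times \<pi> MX IX x"
  define LY where "LY = limit_times \<sigma> MY IY y"
  have LX: "\<tau> \<in> LX q \<longleftrightarrow> (\<forall>n. 0 \<le> \<tau> n) \<and> filterlim \<tau> at_top sequentially \<and> (\<lambda>n. f x (\<tau> n)) \<longlonglongrightarrow> q" for \<tau> q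
    unfolding LX_def limit_times_def f_def by simp
  have LY: "\<tau> \<in> LY q \<longleftrightarrow> (\<forall>n. 0 \<le> \<tau> n) \<and> filterlim \<tau> at_top sequentially \<and> (\<lambda>n. g y (\<tau> n)) \<longlonglongrightarrow> q" for \<tau> q
    unfolding LY_def limit_times_def g_def by simp
  have ex: "\<exists>\<tau>. \<tau> \<in> LX q" if "q \<in> K" for q
    using that unfolding K_def LX_def by (auto simp: positive_limit_set_iff)
  have memK: "q \<in> K" if "\<tau> \<in> LX q" "q \<in> A" for \<tau> q
    using that unfolding K_def LX_def by (auto simp: positive_limit_set_iff)
  obtain h where h: "\<And>q. q \<in> K \<Longrightarrow> LX q \<subseteq> LY (h q)"
    using comparable_imp_ex_limit[OF assms(6)] unfolding LX_def LY_def by metis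
  have cont: "continuous_on K h"
  proof (rule continuous_on_sequentiallyI)
    fix u a assume u: "\<forall>n. u n \<in> K" "a \<in> K" "u \<longlonglongrightarrow> a"
    have "\<exists>t. (\<forall>k. 0 \<le> t k) \<and> filterlim t at_top sequentially
      \<and> (\<lambda>k. f x (t k)) \<longlonglongrightarrow> u n \<and> (\<lambda>k. g y (t k)) \<longlonglongrightarrow> h (u n)" for n
      using ex[of "u n"] h[of "u n"] u(1) LX LY by blast
    \<comment> \<open>Along the diagonal times, \<open>f x\<close> shadows \<open>u\<close> and so
      tends to \<open>a\<close>; hence \<open>r\<close> is in \<open>LX a\<close> and
      \<open>g y\<close> tends to \<open>h a\<close>. But \<open>g y\<close> also shadows the values
      \<open>h (u n)\<close>.\<close>
    then obtain r where r: "\<And>n. 0 \<le> r n" "filterlim r at_top sequentially"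
      "(\<lambda>n. dist (f x (r n)) (u n)) \<longlonglongrightarrow> 0" "(\<lambda>n. dist (g y (r n)) (h (u n))) \<longlonglongrightarrow> 0"
      by (rule ex_diagonal_times[of "f x" u "g y" "\<lambda>n. h (u n)"]) blast
    have "r \<in> LX a" using r(1,2) tendsto_via_dist[OF r(3) u(3)] unfolding LX by blast
    then have "(\<lambda>n. g y (r n)) \<longlonglongrightarrow> h a" using subsetD[OF h[OF u(2)]] LY by simp
    then show "(\<lambda>n. h (u n)) \<longlonglongrightarrow> h a"
      using r(4) by (intro tendsto_via_dist[of "\<lambda>n. h (u n)" "\<lambda>n. g y (r n)"]) (simp_all add: dist_commute)
  qed

  \<comment> \<open>Membership in \<open>K\<close> is carried along because \<open>h\<close> is
    controlled only on \<open>K\<close>.\<close>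
  have equivariant: "f q t \<in> K \<and> h (f q t) = g (h q) t" if q: "q \<in> K - MX" and "0 \<le> t" for q t
  proof -
    \<comment> \<open>The times at which continuous dependence may fail, for the trajectory of
      \<open>q\<close> or of \<open>h q\<close>.\<close>
    define C where "C = {t. \<exists>n p. impulse_stage \<pi> MX IX q n p t}
      \<union> {t. \<exists>n p. impulse_stage \<sigma> MY IY (h q) n p t}"
    have "countable C"
      unfolding C_def using X.countable_impulse_times Y.countable_impulse_times by blast
    have right: "\<exists>T. T \<longlonglongrightarrow> s \<and> (\<forall>k. s < T k) \<and> (\<forall>k. T k \<notin> C)" for s
    proof -
      have "\<exists>r. r \<in> {s<..<s + inverse (real (Suc k))} - C" for k
      proof -
        have "uncountable ({s<..<s + inverse (real (Suc k))} - C)"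
          using \<open>countable C\<close> by (intro uncountable_minus_countable)
            (simp_all add: uncountable_open_interval)
        then have "{s<..<s + inverse (real (Suc k))} - C \<noteq> {}" by (metis countable_empty)
        then show ?thesis by blast
      qed
      then obtain T where T: "\<And>k. s < T k" "\<And>k. T k < s + inverse (real (Suc k))" "\<And>k. T k \<notin> C"
        unfolding Diff_iff greaterThanLessThan_iff by metis
      have "T \<longlonglongrightarrow> s"
        by (rule tendsto_sandwich[OF _ _ tendsto_const, where h = "\<lambda>k. s + inverse (real (Suc k))"])
          (use T LIMSEQ_inverse_real_of_nat_add in \<open>auto intro!: always_eventually less_imp_le\<close>)
      then show ?thesis using T by blast
    qed
    have inA: "f q s \<in> A" if "0 \<le> s" for s
      using assms(4) q that unfolding positively_invariant_def f_def K_def by blast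
    obtain \<tau> where \<tau>: "\<tau> \<in> LX q" using ex q by blast
    then have \<tau>': "\<And>n. 0 \<le> \<tau> n" "filterlim \<tau> at_top sequentially" "(\<lambda>n. f x (\<tau> n)) \<longlonglongrightarrow> q"
      "(\<lambda>n. g y (\<tau> n)) \<longlonglongrightarrow> h q"
      using h q LX LY by blast+
    obtain \<delta> where \<delta>: "0 < \<delta>"
      "\<forall>\<^sub>F n in sequentially. ereal \<delta> \<le> hit_time \<pi> MX (f x (\<tau> n))"
      using X.hit_time_bounded_below_off_impulsive_set[OF \<tau>'(3)] q by blast

    \<comment> \<open>Shifting \<tau> by \<open>s\<close> gives a time sequence for
      \<open>f q s\<close>, by continuous dependence in the first system and the semigroup law. The
      choice of \<open>h\<close> then identifies the limit in the second system.\<close>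
    have step: "f q s \<in> K" "(\<lambda>n. g (g y (\<tau> n)) s) \<longlonglongrightarrow> h (f q s)" if s: "0 \<le> s" "s \<notin> C" for s
    proof -
      have "(\<lambda>n. f (f x (\<tau> n)) s) \<longlonglongrightarrow> f q s"
        unfolding f_def
        using \<tau>'(3) \<delta> s unfolding C_def f_def by (intro X.trajectory_tendsto[where \<delta> = \<delta>]) auto
      then have "(\<lambda>n. f x (\<tau> n + s)) \<longlonglongrightarrow> f q s"
        using \<tau>'(1) s(1) unfolding f_def by (simp add: X.trajectory_add)
      moreover have "filterlim (\<lambda>n. \<tau> n + s) at_top sequentially"
        using \<tau>'(2) filterlim_tendsto_add_at_top[OF tendsto_const \<tau>'(2), of s] by (simp add: add.commute)
      ultimately have *: "(\<lambda>n. \<tau> n + s) \<in> LX (f q s)" using \<tau>'(1) s(1) unfolding LX by simp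
      then show K: "f q s \<in> K" using memK inA s(1) by blast
      have "(\<lambda>n. g y (\<tau> n + s)) \<longlonglongrightarrow> h (f q s)" using subsetD[OF h[OF K] *] LY by simp
      then show "(\<lambda>n. g (g y (\<tau> n)) s) \<longlonglongrightarrow> h (f q s)"
        using \<tau>'(1) s(1) unfolding g_def by (simp add: Y.trajectory_add)
    qed

    \<comment> \<open>At times in \<open>C\<close>, membership in the limit set follows by right
      continuity and closedness, membership in \<open>A\<close> from invariance.\<close>
    have Kq: "f q s \<in> K" if "0 \<le> s" for s
    proof -
      obtain T where T: "T \<longlonglongrightarrow> s" "\<And>k. s < T k" "\<And>k. T k \<notin> C" using right by blast
      have "(\<lambda>k. f q (T k)) \<longlonglongrightarrow> f q s"
        unfolding f_def using T that
        by (intro X.trajectory_right_continuous) (auto intro!: always_eventually less_imp_le)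
      moreover have "f q (T k) \<in> positive_limit_set \<pi> MX IX x" for k
        using step(1)[of "T k"] T(2,3)[of k] that unfolding K_def by simp
      ultimately have "f q s \<in> positive_limit_set \<pi> MX IX x"
        by (rule closed_sequentially[OF closed_positive_limit_set, rotated])
      then show ?thesis using inA[OF that] unfolding K_def by blast
    qed
    have h_right: "(\<lambda>k. h (f q (T k))) \<longlonglongrightarrow> h (f q s)"
      if "0 \<le> s" "T \<longlonglongrightarrow> s" "\<And>k. s < T k" for T :: "nat \<Rightarrow> real" and s
    proof (rule continuous_on_tendsto_compose[OF cont])
      show "(\<lambda>k. f q (T k)) \<longlonglongrightarrow> f q s"
        unfolding f_def using that
        by (intro X.trajectory_right_continuous) (auto intro!: always_eventually less_imp_le)
      show "\<forall>\<^sub>F k in sequentially. f q (T k) \<in> K"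
        using that(1,3) by (intro always_eventually allI Kq) (meson less_imp_le order_trans)
    qed (use Kq that in auto)

    obtain T\<^sub>0 where T\<^sub>0: "T\<^sub>0 \<longlonglongrightarrow> 0" "\<And>k. 0 < T\<^sub>0 k" "\<And>k. T\<^sub>0 k \<notin> C" using right by blast
    \<comment> \<open>\<open>h q\<close> may lie in \<open>MY\<close>, so the bound has to come from
      the return of limits: at times \<open>T\<^sub>0 k\<close> they are
      \<open>h (f q (T\<^sub>0 k))\<close>, which tend to \<open>h q\<close>.\<close>
    have "\<exists>\<delta>>0. \<forall>\<^sub>F n in sequentially. ereal \<delta> \<le> hit_time \<sigma> MY (g y (\<tau> n))"
    proof (rule Y.hit_time_bounded_below_if_limits_return[OF \<tau>'(4) T\<^sub>0(1,2)])
      show "(\<lambda>n. impulsive_trajectory \<sigma> MY IY (g y (\<tau> n)) (T\<^sub>0 k)) \<longlonglongrightarrow> h (f q (T\<^sub>0 k))" for k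
        using step(2)[of "T\<^sub>0 k"] T\<^sub>0(2,3)[of k] unfolding g_def by simp
      have "f q 0 = q" unfolding f_def by (rule X.trajectory_zero)
      then show "(\<lambda>k. h (f q (T\<^sub>0 k))) \<longlonglongrightarrow> h q" using h_right[OF _ T\<^sub>0(1,2)] by simp
    qed
    then obtain \<delta>' where \<delta>': "0 < \<delta>'"
      "\<forall>\<^sub>F n in sequentially. ereal \<delta>' \<le> hit_time \<sigma> MY (g y (\<tau> n))" by blast

    \<comment> \<open>Both sides are limits of the same sequence: one by comparability, the other by
      continuous dependence in the second system.\<close>
    have off_C: "h (f q s) = g (h q) s" if s: "0 \<le> s" "s \<notin> C" for s
    proof (rule LIMSEQ_unique[OF step(2)[OF s]])
      show "(\<lambda>n. g (g y (\<tau> n)) s) \<longlonglongrightarrow> g (h q) s"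
        unfolding g_def
        using \<tau>'(4) \<delta>' s unfolding C_def g_def by (intro Y.trajectory_tendsto[where \<delta> = \<delta>']) auto
    qed
    obtain T where T: "T \<longlonglongrightarrow> t" "\<And>k. t < T k" "\<And>k. T k \<notin> C" using right by blast
    have "h (f q (T k)) = g (h q) (T k)" for k
      using off_C[of "T k"] T(2,3)[of k] \<open>0 \<le> t\<close> by simp
    moreover have "(\<lambda>k. g (h q) (T k)) \<longlonglongrightarrow> g (h q) t"
      unfolding g_def using T \<open>0 \<le> t\<close>
      by (intro Y.trajectory_right_continuous) (auto intro!: always_eventually less_imp_le)
    ultimately have "h (f q t) = g (h q) t"
      using h_right[OF \<open>0 \<le> t\<close> T(1,2)] by (simp add: LIMSEQ_unique)
    then show ?thesis using Kq \<open>0 \<le> t\<close> by blast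
  qed

  have "h ` K \<subseteq> positive_limit_set \<sigma> MY IY y"
    using ex h unfolding LY_def by (fastforce simp: positive_limit_set_iff)
  \<comment> \<open>An impulse leaves \<open>MX\<close> and here stays in \<open>K\<close>, so the
    second conjugacy is the first one applied at \<open>IX q\<close>.\<close>
  moreover have IX: "IX q \<in> K - MX" if "impulse_invariant MX IX K" "q \<in> K \<inter> MX" for q
    using that X.impulse_notin unfolding impulse_invariant_def by blast
  ultimately show ?thesis
    using cont h equivariant unfolding f_def g_def LX_def LY_def
    by (intro exI[of _ h] conjI ballI allI impI) simp_all
qed

end
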